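(* The $q$-Chebyshev polynomials of the second kind satisfy, for all integers $n\ge 2$, $$U_n(x,s,q)=(1+q^n)\,x\,U_{n-1}(x,s,q)+q^{n-1}s\,U_{n-2}(x,s,q),$$ with initial values $U_0(x,s,q)=1$ and $U_1(x,s,q)=(1+q)x$.
   Context: Here $x,s,q$ are indeterminates. Notation: $(a;q)_n=\prod_{j=0}^{n-1}(1-q^ja)$ and $\begin{bmatrix} n\\k\end{bmatrix}=\frac{(q;q)_n}{(q;q)_k(q;q)_{n-k}}$ for $0\le k\le n$. The $q$-Chebyshev polynomials of the second kind are, for $n\ge0$, $$U_n(x,s,q)=\sum_{k=0}^{\lfloor n/2\rfloor}q^{k^2}\begin{bmatrix} n-k\\k\end{bmatrix}(1+q^{k+1})(1+q^{k+2})\cdots(1+q^{n-k})\,s^kx^{n-2k}$$ (an empty product, occurring when $n=2k$, equals $1$). *)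

theory Defs
  imports "HOL-Computational_Algebra.Computational_Algebra"
begin

definition q_poch :: "'a::field \<Rightarrow> 'a \<Rightarrow> nat \<Rightarrow> 'a" where
  "q_poch a q n = (\<Prod>j<n. 1 - q ^ j * a)"

text \<open>Intended for \<open>k \<le> n\<close> only; for \<open>k > n\<close> the subtraction truncates and the value is
  meaningless (it is not \<open>0\<close>).\<close>
definition q_binom :: "'a::field \<Rightarrow> nat \<Rightarrow> nat \<Rightarrow> 'a" where
  "q_binom q n k = q_poch q q n / (q_poch q q k * q_poch q q (n - k))"

text \<open>For \<open>k \<le> n div 2\<close> we have \<open>k \<le> n - k\<close>, so the natural-number subtractions below are exact
  and the arguments of the \<open>q\<close>-binomial are in range.  For \<open>n = 2 * k\<close> the product is empty.\<close>
definition q_cheb_U :: "nat \<Rightarrow> 'a::field \<Rightarrow> 'a \<Rightarrow> 'a \<Rightarrow> 'a" where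
  "q_cheb_U n x s q =
     (\<Sum>k = 0..n div 2.
        q ^ (k ^ 2) * q_binom q (n - k) k * (\<Prod>j = k + 1..n - k. 1 + q ^ j)
          * s ^ k * x ^ (n - 2 * k))"

text \<open>The indeterminates \<open>x\<close>, \<open>s\<close>, \<open>q\<close> are taken in the field of fractions of the polynomial ring
  \<open>R[q][s][x]\<close> over an arbitrary integral domain \<open>R\<close>, so that \<open>x\<close> is the variable of the outermost
  \<open>poly\<close> and \<open>q\<close> that of the innermost.\<close>
type_synonym 'a rat_fun3 = "'a poly poly poly fract"

definition indet_x :: "'a::idom rat_fun3" where
  "indet_x = to_fract [:0, 1:]"

definition indet_s :: "'a::idom rat_fun3" where
  "indet_s = to_fract [:[:0, 1:]:]"

definition indet_q :: "'a::idom rat_fun3" where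
  "indet_q = to_fract [:[:[:0, 1:]:]:]"

end

theory Submission
  imports Defs
begin

text \<open>
  The recurrence holds in every field in which \<open>q\<close> is not a root of unity, and there it is an
  identity between coefficients of \<open>s ^ k * x ^ (n - 2 * k)\<close>.  Let \<open>c n k\<close> be the coefficient in
  \<open>U\<^sub>n\<close>, extended by \<open>0\<close> for \<open>2 * k > n\<close>.  The claim becomes
  \<open>c n k = (1 + q ^ n) * c (n - 1) k + q ^ (n - 1) * c (n - 2) (k - 1)\<close>
  (lemmas \<open>q_cheb_coeff_rec_0\<close> and \<open>q_cheb_coeff_rec_Suc\<close>).
  For \<open>0 < k\<close> and \<open>2 * k < n\<close>, with \<open>m = n - k\<close>, the three terms of this identity are multiples of
  \<open>q ^ k\<^sup>2 * ((q;q)\<^sub>m\<^sub>-\<^sub>1 / ((q;q)\<^sub>k (q;q)\<^sub>m\<^sub>-\<^sub>k)) * (1 + q ^ (k + 1)) \<cdots> (1 + q ^ (m - 1))\<close>,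
  and after cancelling this factor
  \<open>(1 - q ^ m) * (1 + q ^ m)
     = (1 + q ^ (m + k)) * (1 - q ^ (m - k)) + q ^ (m - k) * (1 - q ^ k) * (1 + q ^ k)\<close>
  remains, in which both sides equal \<open>1 - q ^ (2 * m)\<close>.  When \<open>k = 0\<close> or \<open>n = 2 * k\<close>, one term on
  the right is absent and the other one matches directly.  The indeterminate \<open>q\<close> is not a root of
  unity because its powers are distinct monomials.
\<close>

lemma q_poch_0 [simp]: "q_poch a q 0 = 1"
  by (simp add: q_poch_def)

lemma q_poch_self_Suc: "q_poch q q (Suc n) = q_poch q q n * (1 - q ^ Suc n)"
  by (simp add: q_poch_def mult.commute)

lemma q_poch_self_nonzero:
  assumes "\<And>i. i > 0 \<Longrightarrow> q ^ i \<noteq> 1"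
  shows "q_poch q q n \<noteq> 0"
proof (induction n)
  case (Suc n)
  have "q ^ Suc n \<noteq> 1"
    by (rule assms) simp
  with Suc.IH show ?case
    by (simp add: q_poch_self_Suc del: power_Suc)
qed simp

text \<open>The value \<open>0\<close> outside the range \<open>2 * k \<le> n\<close> lets the sums for \<open>U\<^sub>n\<close>, \<open>U\<^sub>n\<^sub>-\<^sub>1\<close> and \<open>U\<^sub>n\<^sub>-\<^sub>2\<close> be
  compared over a common index set, although their numbers of terms differ.\<close>
definition q_cheb_coeff :: "'a::field \<Rightarrow> nat \<Rightarrow> nat \<Rightarrow> 'a" where
  "q_cheb_coeff q n k =
     (if 2 * k \<le> n then q ^ (k ^ 2) * q_binom q (n - k) k * (\<Prod>j = k + 1..n - k. 1 + q ^ j) else 0)"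

lemma q_cheb_coeff_out_of_range: "n < 2 * k \<Longrightarrow> q_cheb_coeff q n k = 0"
  by (simp add: q_cheb_coeff_def)

lemma q_cheb_U_eq_sum_coeff:
  assumes "n div 2 \<le> N"
  shows "q_cheb_U n x s q = (\<Sum>k\<le>N. q_cheb_coeff q n k * s ^ k * x ^ (n - 2 * k))"
proof -
  have "q_cheb_U n x s q = (\<Sum>k = 0..n div 2. q_cheb_coeff q n k * s ^ k * x ^ (n - 2 * k))"
    unfolding q_cheb_U_def q_cheb_coeff_def by (intro sum.cong) auto
  also have "\<dots> = (\<Sum>k\<le>N. q_cheb_coeff q n k * s ^ k * x ^ (n - 2 * k))"
    using assms by (intro sum.mono_neutral_left) (auto simp: q_cheb_coeff_def)
  finally show ?thesis .
qed

lemma q_cheb_coeff_diag: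
  assumes "\<And>i. i > 0 \<Longrightarrow> q ^ i \<noteq> 1"
  shows "q_cheb_coeff q (2 * k) k = q ^ (k ^ 2)"
proof -
  have "2 * k - k = k" by simp
  then show ?thesis
    using q_poch_self_nonzero[OF assms, of k] by (simp add: q_cheb_coeff_def q_binom_def)
qed

text \<open>With \<open>d\<close> the exponent of \<open>x\<close>, the truncating subtractions disappear.\<close>
lemma q_cheb_coeff_add:
  "q_cheb_coeff q (2 * k + d) k =
     q ^ (k ^ 2) * (q_poch q q (k + d) / (q_poch q q k * q_poch q q d)) *
     (\<Prod>j = k + 1..k + d. 1 + q ^ j)"
proof -
  have "2 * k + d - k = k + d" by simp
  then show ?thesis
    by (simp add: q_cheb_coeff_def q_binom_def)
qed

lemma q_cheb_coeff_rec_0: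
  assumes "\<And>i. i > 0 \<Longrightarrow> q ^ i \<noteq> 1"
  shows "q_cheb_coeff q (Suc n) 0 = (1 + q ^ Suc n) * q_cheb_coeff q n 0"
  using q_poch_self_nonzero[OF assms]
  by (simp add: q_cheb_coeff_def q_binom_def mult.commute)

text \<open>In the interior of the range, dividing by the factor common to the three terms leaves
  \<open>(1 - a * b) * (1 + a * b) = (1 + a\<^sup>2 * b) * (1 - b) + b * (1 - a) * (1 + a)\<close>, where
  \<open>a = q ^ (k + 1)\<close> and \<open>b = q ^ (n - 2 * k)\<close>.  At the boundary \<open>n + 2 = 2 * (k + 1)\<close>
  the middle coefficient is out of range, and the identity is \<open>(k + 1)\<^sup>2 = k\<^sup>2 + (2 * k + 1)\<close>
  in the exponent of \<open>q\<close>.\<close>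
lemma q_cheb_coeff_rec_Suc:
  assumes q: "\<And>i. i > 0 \<Longrightarrow> q ^ i \<noteq> 1"
  shows "q_cheb_coeff q (n + 2) (Suc k) =
           (1 + q ^ (n + 2)) * q_cheb_coeff q (n + 1) (Suc k) + q ^ (n + 1) * q_cheb_coeff q n k"
proof -
  have "Suc k ^ 2 = k ^ 2 + (2 * k + 1)"
    by (simp add: power2_eq_square)
  then have sq: "q ^ (Suc k ^ 2) = q ^ (k ^ 2) * q ^ (2 * k + 1)"
    by (simp only: power_add)
  consider "n < 2 * k" | "n = 2 * k" | e where "n = 2 * k + Suc e"
    by (metis add_Suc_right less_imp_Suc_add linorder_neqE_nat)
  then show ?thesis
  proof cases
    case 1
    then show ?thesis by (simp add: q_cheb_coeff_out_of_range)
  next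
    case 2
    have "q_cheb_coeff q (n + 2) (Suc k) = q ^ (Suc k ^ 2)"
      using q_cheb_coeff_diag[OF q, of "Suc k"] 2 by simp
    also have "\<dots> = q ^ (n + 1) * q ^ (k ^ 2)"
      using sq by (simp add: 2)
    finally show ?thesis
      using q_cheb_coeff_diag[OF q, of k] 2 by (simp add: q_cheb_coeff_out_of_range)
  next
    case 3
    (* F below is the common factor; A, B, D collect the q-Pochhammer symbols and P the product
       of the factors 1 + q ^ j that occur in all three coefficients. *)
    define P where "P = (\<Prod>j = k + 2..k + 1 + e. 1 + q ^ j)"
    define A where "A = q_poch q q (k + 1 + e)"
    define B where "B = q_poch q q k"
    define D where "D = q_poch q q e"
    define a where "a = q ^ Suc k"
    define b where "b = q ^ Suc e"
    define F where "F = q ^ (k ^ 2) * q ^ (2 * k + 1) * (A / (B * (1 - a) * (D * (1 - b)))) * P"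
    have nz: "B \<noteq> 0" "D \<noteq> 0" "1 - a \<noteq> 0" "1 - b \<noteq> 0"
      using q_poch_self_nonzero[OF q] q[of "Suc k"] q[of "Suc e"]
      by (auto simp: B_def D_def a_def b_def simp del: power_Suc)
    have ab: "q ^ (k + 2 + e) = a * b"
      by (simp add: a_def b_def power_add mult_ac)
    have poch: "q_poch q q (Suc k) = B * (1 - a)" "q_poch q q (Suc e) = D * (1 - b)"
      "q_poch q q (k + 2 + e) = A * (1 - a * b)"
      using q_poch_self_Suc[of q "k + 1 + e"] ab
      by (simp_all add: q_poch_self_Suc A_def B_def D_def a_def b_def)
    have prods: "(\<Prod>j = k + 2..k + 2 + e. 1 + q ^ j) = P * (1 + a * b)"
      "(\<Prod>j = k + 1..k + 1 + e. 1 + q ^ j) = (1 + a) * P"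
    proof -
      show "(\<Prod>j = k + 2..k + 2 + e. 1 + q ^ j) = P * (1 + a * b)"
        using ab by (simp add: P_def)
      show "(\<Prod>j = k + 1..k + 1 + e. 1 + q ^ j) = (1 + a) * P"
        using prod.atLeast_Suc_atMost[of "k + 1" "k + 1 + e" "\<lambda>j. 1 + q ^ j"]
        by (simp add: P_def a_def)
    qed
    have c2: "q_cheb_coeff q (n + 2) (Suc k) = F * ((1 - a * b) * (1 + a * b))"
      using q_cheb_coeff_add[of q "Suc k" "Suc e"] prods(1) poch sq 3
      by (simp add: F_def)
    have c1: "q_cheb_coeff q (n + 1) (Suc k) = F * (1 - b)"
      using q_cheb_coeff_add[of q "Suc k" e] poch sq 3 nz
      by (simp add: F_def P_def A_def D_def mult_ac)
    have c0: "q ^ (n + 1) * q_cheb_coeff q n k = F * (b * (1 - a) * (1 + a))"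
    proof -
      have "q ^ (n + 1) = q ^ (2 * k + 1) * b"
        by (simp add: 3 b_def flip: power_add)
      moreover have "q_cheb_coeff q n k = q ^ (k ^ 2) * (A / (B * (D * (1 - b)))) * ((1 + a) * P)"
        using q_cheb_coeff_add[of q k "Suc e"] prods(2) poch 3
        by (simp add: A_def B_def)
      ultimately show ?thesis
        using nz by (auto simp: F_def)
    qed
    have "n + 2 = Suc k + Suc k + Suc e"
      using 3 by simp
    then have "q ^ (n + 2) = a * a * b"
      by (simp only: a_def b_def power_add)
    then show ?thesis
      unfolding c2 c1 c0 by (simp add: algebra_simps)
  qed
qed

text \<open>If \<open>q\<close> were a root of unity, vanishing denominators would turn \<open>q\<close>-binomials into \<open>0\<close> and
  destroy the cancellations between them.\<close>
lemma q_cheb_U_rec: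
  assumes q: "\<And>i. i > 0 \<Longrightarrow> q ^ i \<noteq> 1"
  shows "q_cheb_U (n + 2) x s q =
           (1 + q ^ (n + 2)) * x * q_cheb_U (n + 1) x s q + q ^ (n + 1) * s * q_cheb_U n x s q"
proof -
  let ?c = "q_cheb_coeff q"
  have U2: "q_cheb_U (n + 2) x s q =
      ?c (n + 2) 0 * x ^ (n + 2) + (\<Sum>k\<le>n. ?c (n + 2) (Suc k) * s ^ Suc k * x ^ (n - 2 * k))"
    by (subst q_cheb_U_eq_sum_coeff[of _ "Suc n"], simp, subst sum.atMost_Suc_shift) simp
  have U1: "q_cheb_U (n + 1) x s q =
      ?c (n + 1) 0 * x ^ (n + 1) +
      (\<Sum>k\<le>n. ?c (n + 1) (Suc k) * s ^ Suc k * x ^ (n + 1 - 2 * Suc k))"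
    by (subst q_cheb_U_eq_sum_coeff[of _ "Suc n"], simp, subst sum.atMost_Suc_shift) simp
  have U0: "q_cheb_U n x s q = (\<Sum>k\<le>n. ?c n k * s ^ k * x ^ (n - 2 * k))"
    by (rule q_cheb_U_eq_sum_coeff) simp
  have term_rec: "?c (n + 2) (Suc k) * s ^ Suc k * x ^ (n - 2 * k) =
      (1 + q ^ (n + 2)) * x * (?c (n + 1) (Suc k) * s ^ Suc k * x ^ (n + 1 - 2 * Suc k)) +
      q ^ (n + 1) * s * (?c n k * s ^ k * x ^ (n - 2 * k))" for k
  proof -
    (* If the exponent of x truncates, the coefficient in front of it vanishes. *)
    have "?c (n + 1) (Suc k) * (x * x ^ (n + 1 - 2 * Suc k)) = ?c (n + 1) (Suc k) * x ^ (n - 2 * k)"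
    proof (cases "2 * Suc k \<le> n + 1")
      case True
      then have "Suc (n + 1 - 2 * Suc k) = n - 2 * k" by simp
      then show ?thesis by (metis power_Suc)
    qed (simp add: q_cheb_coeff_out_of_range)
    from arg_cong[OF this, of "\<lambda>t. (1 + q ^ (n + 2)) * s ^ Suc k * t"]
    have x_term: "(1 + q ^ (n + 2)) * x * (?c (n + 1) (Suc k) * s ^ Suc k * x ^ (n + 1 - 2 * Suc k)) =
        (1 + q ^ (n + 2)) * s ^ Suc k * (?c (n + 1) (Suc k) * x ^ (n - 2 * k))"
      by (simp only: mult_ac)
    have coeff_rec: "?c (n + 2) (Suc k) =
        (1 + q ^ (n + 2)) * ?c (n + 1) (Suc k) + q ^ (n + 1) * ?c n k"
      by (intro q_cheb_coeff_rec_Suc q)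
    show ?thesis
      unfolding x_term coeff_rec
      by (simp only: power_Suc distrib_right distrib_left mult_1_left ac_simps)
  qed
  have "?c (n + 2) 0 * x ^ (n + 2) = (1 + q ^ (n + 2)) * x * (?c (n + 1) 0 * x ^ (n + 1))"
    using q_cheb_coeff_rec_0[OF q, of "n + 1"] by simp
  then show ?thesis
    unfolding U2 U1 U0 term_rec sum.distrib by (simp only: sum_distrib_left distrib_left add.assoc)
qed

lemma to_fract_power: "to_fract (p ^ i) = to_fract p ^ i"
  by (induction i) simp_all

lemma indet_q_power_neq_1:
  assumes "i > 0"
  shows "(indet_q :: 'a::idom rat_fun3) ^ i \<noteq> 1"
proof
  assume "(indet_q :: 'a rat_fun3) ^ i = 1"
  then have "to_fract ([:[:[:0, 1:]:]:] ^ i) = to_fract (1 :: 'a poly poly poly)"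
    by (simp add: indet_q_def to_fract_power)
  then have "[:[:[:0, 1:]:]:] ^ i = (1 :: 'a poly poly poly)"
    by (simp only: to_fract_eq_iff)
  then have "[:0, 1:] ^ i = (1 :: 'a poly)"
    by (simp add: poly_const_pow one_pCons)
  then have "degree ([:0, 1 :: 'a:] ^ i) = 0"
    by simp
  with assms show False
    by (simp add: degree_power_eq)
qed

theorem theorem5p1:
  fixes x s q :: "'a::idom rat_fun3"
  defines "x \<equiv> indet_x" and "s \<equiv> indet_s" and "q \<equiv> indet_q"
  shows "(\<forall>n\<ge>2. q_cheb_U n x s q =
            (1 + q ^ n) * x * q_cheb_U (n - 1) x s q + q ^ (n - 1) * s * q_cheb_U (n - 2) x s q)
         \<and> q_cheb_U 0 x s q = 1
         \<and> q_cheb_U 1 x s q = (1 + q) * x"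
proof (intro conjI allI impI)
  have q: "q ^ i \<noteq> 1" if "i > 0" for i
    unfolding q_def using that by (rule indet_q_power_neq_1)
  show "q_cheb_U n x s q =
      (1 + q ^ n) * x * q_cheb_U (n - 1) x s q + q ^ (n - 1) * s * q_cheb_U (n - 2) x s q"
    if "n \<ge> 2" for n
  proof -
    from that obtain m where "n = m + 2"
      by (metis add.commute le_Suc_ex)
    then show ?thesis
      using q_cheb_U_rec[OF q, of m x s] by simp
  qed
  show "q_cheb_U 0 x s q = 1"
    by (simp add: q_cheb_U_def q_binom_def)
  show "q_cheb_U 1 x s q = (1 + q) * x"
    using q_poch_self_nonzero[OF q, of 1] by (simp add: q_cheb_U_def q_binom_def)
qed

end
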